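(* Assume the standing setting and assumptions given in the context, and let $N\in\mathbb{N}$ with $N\ge 1$ be arbitrary. The $T$-controllable set $\mathcal{C}_T$ is a robust positively invariant set for the uncertain dynamics $x^+\in Ax+B\kappa_T(x)\oplus\mathcal{W}$ and constraints $(x,\kappa_T(x))\in\mathcal{Y}$, i.e., $$\forall x\in\mathcal{C}_T,\quad Ax+B\kappa_T(x)\oplus\mathcal{W}\subseteq\mathcal{C}_T\quad\text{and}\quad(x,\kappa_T(x))\in\mathcal{Y}.$$
   Context: Notation. $\mathbb{N}$ is the set of non-negative integers; $\mathbb{N}_b=\{0,1,\dots,b\}$ for $b\in\mathbb{N}$, and $\mathbb{N}_{-1}=\emptyset$. Empty sums are $0$. $\rho(M)$ is the spectral radius; a square matrix $M$ is strictly stable iff $\rho(M)<1$. $\bigoplus$ and $\oplus$ denote Minkowski sums (a point is identified with a singleton). For a set $\mathcal{X}$, matrix $M$ and $k\in\mathbb{N}$, $M^k\mathcal{X}=\{M^kx: x\in\mathcal{X}\}$ and $M^{-k}\mathcal{X}=\{y: M^ky\in\mathcal{X}\}$ (preimage; $M$ need not be invertible). A proper $D$-set is a closed convex set containing the origin in its interior; a proper $C$-set is a bounded proper $D$-set. A polyhedral set is an intersection of finitely many closed half-spaces; a polytopic set is a bounded polyhedral set. The support function is $h(\mathcal{X},y)=\sup\{y^\top x: x\in\mathcal{X}\}$. Setting and assumptions. - $A\in\mathbb{R}^{n\times n}$, $B\in\mathbb{R}^{n\times m}$, and $(A,B)$ is strictly stabilizable (some $K$ makes $A+BK$ strictly stable).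 - $\mathcal{Y}=\{(x,u)\in\mathbb{R}^n\times\mathbb{R}^m: c_i^\top x+d_i^\top u\le 1\ \forall i\in\mathcal{I}_{\mathcal{Y}}\}$, $\mathcal{I}_{\mathcal{Y}}=\{1,\dots,p\}$, is a polyhedral proper $D$-set and this representation is irreducible (no inequality is redundant). - $\mathcal{W}=\{w\in\mathbb{R}^n: e_i^\top w\le 1\ \forall i\in\mathcal{I}_{\mathcal{W}}\}$, $\mathcal{I}_{\mathcal{W}}=\{1,\dots,q\}$, is a polytopic proper $C$-set and this representation is irreducible. - $Q\in\mathbb{R}^{n\times n}$ and $R\in\mathbb{R}^{m\times m}$ are symmetric positive definite. - $K_{\mathcal{S}}\in\mathbb{R}^{m\times n}$ is such that $A+BK_{\mathcal{S}}$ is strictly stable. - $\mathcal{S}=(1-\alpha)^{-1}\bigoplus_{j=0}^{N_{\mathcal{S}}-1}(A+BK_{\mathcal{S}})^j\mathcal{W}$, where $\alpha\in[0,1)$ and $N_{\mathcal{S}}\in\mathbb{N}$ satisfy $(A+BK_{\mathcal{S}})^{N_{\mathcal{S}}}\mathcal{W}\subseteq\alpha\mathcal{W}$. - With $f_i:=h(\mathcal{S},c_i+K_{\mathcal{S}}^\top d_i)$, one has $f_i<1$ for all $i\in\mathcal{I}_{\mathcal{Y}}$. - $\mathcal{Y}_{\mathcal{S}}=\{(z,v): (z+s,v+K_{\mathcal{S}}s)\in\mathcal{Y}\ \forall s\in\mathcal{S}\}$. - $K_{\mathcal{Z}}\in\mathbb{R}^{m\times n}$ is such that $A+BK_{\mathcal{Z}}$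 is strictly stable; $\mathcal{Z}_{\mathcal{S}}=\{z: (z,K_{\mathcal{Z}}z)\in\mathcal{Y}_{\mathcal{S}}\}$. - $\mathcal{Z}_f=\bigcap_{j=0}^{N_{\mathcal{Z}}}(A+BK_{\mathcal{Z}})^{-j}\mathcal{Z}_{\mathcal{S}}$, where $N_{\mathcal{Z}}\in\mathbb{N}$ satisfies $\bigcap_{j=0}^{N_{\mathcal{Z}}}(A+BK_{\mathcal{Z}})^{-j}\mathcal{Z}_{\mathcal{S}}\subseteq(A+BK_{\mathcal{Z}})^{-(N_{\mathcal{Z}}+1)}\mathcal{Z}_{\mathcal{S}}$. - $P\in\mathbb{R}^{n\times n}$ is symmetric positive definite with $(A+BK_{\mathcal{Z}})^\top P(A+BK_{\mathcal{Z}})-P\preceq-(Q+K_{\mathcal{Z}}^\top RK_{\mathcal{Z}})$. Put $Q_{\mathcal{Z}}:=Q+K_{\mathcal{Z}}^\top RK_{\mathcal{Z}}$. Problem $\mathfrak{P}_T(x)$. $T=(N,N_{\mathcal{S}},N_{\mathcal{Z}})$. The decision variable is $\mathbf{d}_T=(\mathbf{z}_{N-1},\mathbf{v}_{N-1},\mathbf{z}_{[N:N+N_{\mathcal{Z}}]},\boldsymbol{\omega}_{N_{\mathcal{S}}-1})$ with $\mathbf{z}_{N-1}=\{z_k\}_{k=0}^{N-1}$, $\mathbf{v}_{N-1}=\{v_k\}_{k=0}^{N-1}$, $\mathbf{z}_{[N:N+N_{\mathcal{Z}}]}=\{z_k\}_{k=N}^{N+N_{\mathcal{Z}}}$, $\boldsymbol{\omega}_{N_{\mathcal{S}}-1}=\{\omega_k\}_{k=0}^{N_{\mathcal{S}}-1}$,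 where $z_k,\omega_k\in\mathbb{R}^n$, $v_k\in\mathbb{R}^m$. The cost is $$V_T(\mathbf{d}_T)=\sum_{k=0}^{N-1}(z_k^\top Qz_k+v_k^\top Rv_k)+\sum_{k=N}^{N+N_{\mathcal{Z}}-1}z_k^\top Q_{\mathcal{Z}}z_k+z_{N+N_{\mathcal{Z}}}^\top Pz_{N+N_{\mathcal{Z}}}.$$ For $x\in\mathbb{R}^n$, $\mathfrak{P}_T(x)$ is: minimize $V_T(\mathbf{d}_T)$ over $\mathbf{d}_T$ subject to (a) $x=z_0+(1-\alpha)^{-1}\sum_{j=0}^{N_{\mathcal{S}}-1}(A+BK_{\mathcal{S}})^j\omega_j$; (b) $e_i^\top\omega_j\le1$ for all $j\in\mathbb{N}_{N_{\mathcal{S}}-1}$, $i\in\mathcal{I}_{\mathcal{W}}$; (c) $z_{k+1}=Az_k+Bv_k$ for all $k\in\mathbb{N}_{N-1}$; (d) $c_i^\top z_k+d_i^\top v_k\le1-f_i$ for all $k\in\mathbb{N}_{N-1}$, $i\in\mathcal{I}_{\mathcal{Y}}$; (e) $z_{N+k+1}=(A+BK_{\mathcal{Z}})z_{N+k}$ for all $k\in\mathbb{N}_{N_{\mathcal{Z}}-1}$; (f) $(c_i^\top+d_i^\top K_{\mathcal{Z}})z_{N+k}\le1-f_i$ for all $k\in\mathbb{N}_{N_{\mathcal{Z}}}$, $i\in\mathcal{I}_{\mathcal{Y}}$. $\mathcal{C}_T$ (the $T$-controllable set) is the set of $x$ for which (a)-(f) are feasible. For $x\in\mathcal{C}_T$,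 the $z_k$ and $v_k$ components of a minimizer of $\mathfrak{P}_T(x)$ are uniquely determined and denoted $z_k^0(x)$, $v_k^0(x)$. Control law. The implicit rigid tube MPC law is $\kappa_T:\mathcal{C}_T\to\mathbb{R}^m$, $\kappa_T(x)=v_0^0(x)+K_{\mathcal{S}}(x-z_0^0(x))$. *)

theory Defs
  imports "HOL-Analysis.Analysis" "HOL-Library.Set_Algebras"
begin

section \<open>Matrices\<close>

text \<open>On the vector types, \<open>*\<close> (and hence \<open>^\<close>) is componentwise, so powers with
  respect to the matrix product \<open>**\<close> have to be introduced separately.\<close>

primrec mat_pow :: "real^'n^'n \<Rightarrow> nat \<Rightarrow> real^'n^'n" where
  "mat_pow M 0 = mat 1"
| "mat_pow M (Suc k) = M ** mat_pow M k"

definition pow_image :: "real^'n^'n \<Rightarrow> nat \<Rightarrow> (real^'n) set \<Rightarrow> (real^'n) set" where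
  "pow_image M k X = (\<lambda>x. mat_pow M k *v x) ` X"

definition pow_preimage :: "real^'n^'n \<Rightarrow> nat \<Rightarrow> (real^'n) set \<Rightarrow> (real^'n) set" where
  "pow_preimage M k X = (\<lambda>x. mat_pow M k *v x) -` X"

text \<open>Eigenvalues of a real matrix are taken over the complex numbers; there is
  at least one and there are at most \<open>CARD('n)\<close> of them, so \<open>Max\<close> below is meaningful.\<close>

definition spectrum :: "real^'n^'n \<Rightarrow> complex set" where
  "spectrum M = {l. \<exists>v :: complex^'n. v \<noteq> 0 \<and> map_matrix complex_of_real M *v v = l *s v}"

definition spectral_radius :: "real^'n^'n \<Rightarrow> real" where
  "spectral_radius M = Max (cmod ` spectrum M)"

definition strictly_stable :: "real^'n^'n \<Rightarrow> bool" where
  "strictly_stable M \<longleftrightarrow> spectral_radius M < 1"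

definition strictly_stabilizable :: "real^'n^'n \<Rightarrow> real^'m^'n \<Rightarrow> bool" where
  "strictly_stabilizable A B \<longleftrightarrow> (\<exists>K :: real^'n^'m. strictly_stable (A + B ** K))"

definition sym_pos_def :: "real^'n^'n \<Rightarrow> bool" where
  "sym_pos_def M \<longleftrightarrow> transpose M = M \<and> (\<forall>x. x \<noteq> 0 \<longrightarrow> x \<bullet> (M *v x) > 0)"

definition sym_pos_semidef :: "real^'n^'n \<Rightarrow> bool" where
  "sym_pos_semidef M \<longleftrightarrow> transpose M = M \<and> (\<forall>x. x \<bullet> (M *v x) \<ge> 0)"

definition loewner_le :: "real^'n^'n \<Rightarrow> real^'n^'n \<Rightarrow> bool" where
  "loewner_le L M \<longleftrightarrow> sym_pos_semidef (M - L)"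

section \<open>Convex sets\<close>

definition proper_D_set :: "'a::euclidean_space set \<Rightarrow> bool" where
  "proper_D_set X \<longleftrightarrow> closed X \<and> convex X \<and> 0 \<in> interior X"

definition proper_C_set :: "'a::euclidean_space set \<Rightarrow> bool" where
  "proper_C_set X \<longleftrightarrow> bounded X \<and> proper_D_set X"

text \<open>The representation of \<open>\<Inter>i\<in>I. H i\<close> as an intersection of the sets \<open>H i\<close> is
  irreducible if dropping any single \<open>H i\<close> changes the intersection.\<close>

definition irreducible_rep :: "'i set \<Rightarrow> ('i \<Rightarrow> 'a set) \<Rightarrow> bool" where
  "irreducible_rep I H \<longleftrightarrow> (\<forall>i\<in>I. (\<Inter>j\<in>I - {i}. H j) \<noteq> (\<Inter>j\<in>I. H j))"

text \<open>Meaningful for nonempty \<open>X\<close> that is bounded in direction \<open>y\<close>; below it is only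
  applied to the bounded nonempty tube cross-section.\<close>

definition support_function :: "'a::euclidean_space set \<Rightarrow> 'a \<Rightarrow> real" where
  "support_function X y = (SUP x\<in>X. y \<bullet> x)"

section \<open>Implicit rigid tube model predictive control\<close>

text \<open>A decision variable \<open>(z, v, \<omega>)\<close> is given by three sequences, of which only the
  entries \<open>z 0, \<dots>, z (N + N\<^sub>Z)\<close>, \<open>v 0, \<dots>, v (N - 1)\<close> and \<open>\<omega> 0, \<dots>, \<omega> (N\<^sub>S - 1)\<close>
  enter the constraints and the cost.\<close>

type_synonym ('n, 'm) decision =
  "(nat \<Rightarrow> real^'n) \<times> (nat \<Rightarrow> real^'m) \<times> (nat \<Rightarrow> real^'n)"

locale rigid_tube_mpc_data =
  fixes A :: "real^'n^'n"
    and B :: "real^'m^'n"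
    and p :: nat
    and c :: "nat \<Rightarrow> real^'n"
    and d :: "nat \<Rightarrow> real^'m"
    and q :: nat
    and e :: "nat \<Rightarrow> real^'n"
    and Q :: "real^'n^'n"
    and R :: "real^'m^'m"
    and P :: "real^'n^'n"
    and K\<^sub>S :: "real^'n^'m"
    and \<alpha> :: real
    and N\<^sub>S :: nat
    and K\<^sub>Z :: "real^'n^'m"
    and N\<^sub>Z :: nat
    and N :: nat
begin

definition Y_halfspace :: "nat \<Rightarrow> ((real^'n) \<times> (real^'m)) set" where
  "Y_halfspace i = {(x, u). c i \<bullet> x + d i \<bullet> u \<le> 1}"

definition Y_set :: "((real^'n) \<times> (real^'m)) set" where
  "Y_set = (\<Inter>i\<in>{1..p}. Y_halfspace i)"

definition W_halfspace :: "nat \<Rightarrow> (real^'n) set" where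
  "W_halfspace i = {w. e i \<bullet> w \<le> 1}"

definition W_set :: "(real^'n) set" where
  "W_set = (\<Inter>i\<in>{1..q}. W_halfspace i)"

text \<open>The sum is a Minkowski sum of sets; the empty one is \<open>{0}\<close>.\<close>

definition S_set :: "(real^'n) set" where
  "S_set = (*\<^sub>R) (1 / (1 - \<alpha>)) ` (\<Sum>j<N\<^sub>S. pow_image (A + B ** K\<^sub>S) j W_set)"

definition f :: "nat \<Rightarrow> real" where
  "f i = support_function S_set (c i + transpose K\<^sub>S *v d i)"

definition Y_S :: "((real^'n) \<times> (real^'m)) set" where
  "Y_S = {(z, v). \<forall>s\<in>S_set. (z + s, v + K\<^sub>S *v s) \<in> Y_set}"

definition Z_S :: "(real^'n) set" where
  "Z_S = {z. (z, K\<^sub>Z *v z) \<in> Y_S}"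

definition Z_f :: "(real^'n) set" where
  "Z_f = (\<Inter>j\<in>{0..N\<^sub>Z}. pow_preimage (A + B ** K\<^sub>Z) j Z_S)"

definition Q_Z :: "real^'n^'n" where
  "Q_Z = Q + transpose K\<^sub>Z ** R ** K\<^sub>Z"

fun cost :: "('n, 'm) decision \<Rightarrow> real" where
  "cost (z, v, \<omega>) =
     (\<Sum>k<N. z k \<bullet> (Q *v z k) + v k \<bullet> (R *v v k))
     + (\<Sum>k\<in>{N..<N + N\<^sub>Z}. z k \<bullet> (Q_Z *v z k))
     + z (N + N\<^sub>Z) \<bullet> (P *v z (N + N\<^sub>Z))"

fun feasible :: "real^'n \<Rightarrow> ('n, 'm) decision \<Rightarrow> bool" where
  "feasible x (z, v, \<omega>) \<longleftrightarrow>
     x = z 0 + (1 / (1 - \<alpha>)) *\<^sub>R (\<Sum>j<N\<^sub>S. mat_pow (A + B ** K\<^sub>S) j *v \<omega> j) \<and>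
     (\<forall>j<N\<^sub>S. \<forall>i\<in>{1..q}. e i \<bullet> \<omega> j \<le> 1) \<and>
     (\<forall>k<N. z (k + 1) = A *v z k + B *v v k) \<and>
     (\<forall>k<N. \<forall>i\<in>{1..p}. c i \<bullet> z k + d i \<bullet> v k \<le> 1 - f i) \<and>
     (\<forall>k<N\<^sub>Z. z (N + k + 1) = (A + B ** K\<^sub>Z) *v z (N + k)) \<and>
     (\<forall>k\<le>N\<^sub>Z. \<forall>i\<in>{1..p}. (c i + transpose K\<^sub>Z *v d i) \<bullet> z (N + k) \<le> 1 - f i)"

definition controllable_set :: "(real^'n) set" where
  "controllable_set = {x. \<exists>D. feasible x D}"

definition minimizer :: "real^'n \<Rightarrow> ('n, 'm) decision \<Rightarrow> bool" where
  "minimizer x D \<longleftrightarrow> is_arg_min cost (feasible x) D"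

text \<open>The \<open>z\<close> and \<open>v\<close> components of a minimizer are unique, whereas \<open>\<omega>\<close> need not be.\<close>

definition z_opt :: "nat \<Rightarrow> real^'n \<Rightarrow> real^'n" where
  "z_opt k x = (THE y. \<exists>z v \<omega>. minimizer x (z, v, \<omega>) \<and> z k = y)"

definition v_opt :: "nat \<Rightarrow> real^'n \<Rightarrow> real^'m" where
  "v_opt k x = (THE y. \<exists>z v \<omega>. minimizer x (z, v, \<omega>) \<and> v k = y)"

definition \<kappa> :: "real^'n \<Rightarrow> real^'m" where
  "\<kappa> x = v_opt 0 x + K\<^sub>S *v (x - z_opt 0 x)"

end

locale rigid_tube_mpc = rigid_tube_mpc_data A B p c d q e Q R P K\<^sub>S \<alpha> N\<^sub>S K\<^sub>Z N\<^sub>Z N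
  for A :: "real^'n^'n" and B :: "real^'m^'n"
    and p c d q e Q R P K\<^sub>S \<alpha> N\<^sub>S K\<^sub>Z N\<^sub>Z N +
  assumes stabilizable: "strictly_stabilizable A B"
    and Y_polyhedron: "polyhedron Y_set"
    and Y_proper: "proper_D_set Y_set"
    and Y_irreducible: "irreducible_rep {1..p} Y_halfspace"
    and W_polyhedron: "polyhedron W_set"
    and W_proper: "proper_C_set W_set"
    and W_irreducible: "irreducible_rep {1..q} W_halfspace"
    and Q_pos: "sym_pos_def Q"
    and R_pos: "sym_pos_def R"
    and K_S_stable: "strictly_stable (A + B ** K\<^sub>S)"
    and \<alpha>_range: "0 \<le> \<alpha>" "\<alpha> < 1"
    and N_S: "pow_image (A + B ** K\<^sub>S) N\<^sub>S W_set \<subseteq> (*\<^sub>R) \<alpha> ` W_set"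
    and f_less_1: "\<And>i. i \<in> {1..p} \<Longrightarrow> f i < 1"
    and K_Z_stable: "strictly_stable (A + B ** K\<^sub>Z)"
    and N_Z: "Z_f \<subseteq> pow_preimage (A + B ** K\<^sub>Z) (N\<^sub>Z + 1) Z_S"
    and P_pos: "sym_pos_def P"
    and P_lyapunov:
      "loewner_le (transpose (A + B ** K\<^sub>Z) ** P ** (A + B ** K\<^sub>Z) - P) (- Q_Z)"

definition robust_positively_invariant ::
    "real^'n^'n \<Rightarrow> real^'m^'n \<Rightarrow> (real^'n) set \<Rightarrow> ((real^'n) \<times> (real^'m)) set \<Rightarrow>
     (real^'n \<Rightarrow> real^'m) \<Rightarrow> (real^'n) set \<Rightarrow> bool" where
  "robust_positively_invariant A B W Y k C \<longleftrightarrow>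
     (\<forall>x\<in>C. {A *v x + B *v k x} + W \<subseteq> C \<and> (x, k x) \<in> Y)"

end

theory Submission
  imports Defs
begin

text \<open>Strict convexity and coercivity of the cost make the optimal \<open>z\<^sub>0\<close>, \<open>v\<^sub>0\<close> well defined. Write
  \<open>x = z\<^sub>0 + s\<close> with \<open>s \<in> S\<close>. The successor is \<open>z\<^sub>1 + ((A + B K\<^sub>S) s + w)\<close>, the second summand
  lies in \<open>S\<close> again, and shifting the optimal trajectory by one step, continued
  by the terminal controller \<open>K\<^sub>Z\<close>, gives a feasible point for the successor.\<close>

section \<open>Quadratic forms\<close>

lemma pos_def_nonneg:
  fixes M :: "real^'n^'n"
  assumes "\<And>x. x \<noteq> 0 \<Longrightarrow> x \<bullet> (M *v x) > 0"
  shows "x \<bullet> (M *v x) \<ge> 0"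
  using assms[of x] by (cases "x = 0") auto

text \<open>Compactness of the unit sphere gives the form a positive minimum \<open>l\<close> there,
  and homogeneity of degree two turns this into a global quadratic lower bound.\<close>

lemma pos_def_sublevel_bounded:
  fixes M :: "real^'n^'n"
  assumes pos: "\<And>x. x \<noteq> 0 \<Longrightarrow> x \<bullet> (M *v x) > 0"
  obtains r where "\<And>x. x \<bullet> (M *v x) \<le> b \<Longrightarrow> norm x \<le> r"
proof -
  have "continuous_on (sphere 0 1) (\<lambda>x. x \<bullet> (M *v x))"
    by (intro continuous_intros linear_continuous_on matrix_vector_mul_bounded_linear)
  moreover have "sphere (0::real^'n) 1 \<noteq> {}"
    by simp
  ultimately obtain u where u: "u \<in> sphere 0 1"
    "\<And>x. x \<in> sphere 0 1 \<Longrightarrow> u \<bullet> (M *v u) \<le> x \<bullet> (M *v x)"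
    using continuous_attains_inf[OF compact_sphere] by blast
  define l where "l = u \<bullet> (M *v u)"
  have "l > 0"
    unfolding l_def using u(1) by (intro pos) auto
  have lower: "l * (norm x)\<^sup>2 \<le> x \<bullet> (M *v x)" for x
  proof (cases "x = 0")
    case False
    have "l \<le> (x /\<^sub>R norm x) \<bullet> (M *v (x /\<^sub>R norm x))"
      unfolding l_def using False by (intro u(2)) simp
    also have "\<dots> = x \<bullet> (M *v x) / (norm x)\<^sup>2"
      by (simp add: matrix_vector_mult_scaleR power2_eq_square divide_simps)
    finally show ?thesis
      using False by (simp add: field_simps)
  qed simp
  have "norm x \<le> sqrt (b / l)" if "x \<bullet> (M *v x) \<le> b" for x
    using lower[of x] that \<open>l > 0\<close> by (intro real_le_rsqrt) (simp add: field_simps)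
  then show thesis
    by (rule that)
qed

text \<open>An exact form of strict convexity: the midpoint falls below the average by the form of
  half the difference, because the cross terms cancel. Uniqueness of the optimal trajectory rests on
  it.\<close>

lemma quadratic_form_parallelogram:
  fixes M :: "real^'n^'n"
  shows "((1/2) *\<^sub>R (x + y)) \<bullet> (M *v ((1/2) *\<^sub>R (x + y))) + ((1/2) *\<^sub>R (x - y)) \<bullet> (M *v ((1/2) *\<^sub>R (x - y)))
    = (1/2) * (x \<bullet> (M *v x)) + (1/2) * (y \<bullet> (M *v y))"
  by (simp add: matrix_vector_mult_scaleR algebra_simps inner_simps)

lemma inner_transpose_mult:
  fixes M :: "real^'n^'m"
  shows "(transpose M *v y) \<bullet> x = y \<bullet> (M *v x)"
  by (simp add: dot_lmul_matrix)

section \<open>Topology of sequence spaces\<close>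

text \<open>Tychonoff, transferred to the topology of the function type, so that infinite decision
  sequences can live in a compact box.\<close>

lemma compact_PiE_UNIV:
  fixes X :: "'i \<Rightarrow> 'a::topological_space set"
  assumes "\<And>i. compact (X i)"
  shows "compact (PiE UNIV X)"
proof -
  have "compactin (product_topology (\<lambda>i. euclidean) UNIV) (PiE UNIV X)"
    using assms by (simp add: compactin_PiE)
  then show ?thesis
    by (simp add: euclidean_product_topology)
qed

text \<open>Guards such as \<open>k < N\<close> do not depend on the decision variable; this rule
  lets closedness proofs pass through them.\<close>

lemma closed_Collect_imp_const:
  assumes "C \<Longrightarrow> closed {x. P x}"
  shows "closed {x. C \<longrightarrow> P x}"
  using assms by (cases C) auto

lemma continuous_on_matrix_vector_mult [continuous_intros]:
  fixes M :: "real^'n^'m"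
  assumes "continuous_on S g"
  shows "continuous_on S (\<lambda>x. M *v g x)"
  using assms by (rule bounded_linear.continuous_on[OF matrix_vector_mul_bounded_linear])

context rigid_tube_mpc
begin

declare cost.simps [simp del] feasible.simps [simp del]

section \<open>The optimal control problem\<close>

lemma Q_posD: "x \<noteq> 0 \<Longrightarrow> x \<bullet> (Q *v x) > 0"
  and R_posD: "u \<noteq> 0 \<Longrightarrow> u \<bullet> (R *v u) > 0"
  and P_posD: "x \<noteq> 0 \<Longrightarrow> x \<bullet> (P *v x) > 0"
  using Q_pos R_pos P_pos by (auto simp: sym_pos_def_def)

lemma Q_Z_posD:
  assumes "x \<noteq> 0"
  shows "x \<bullet> (Q_Z *v x) > 0"
proof -
  have "x \<bullet> (Q_Z *v x) = x \<bullet> (Q *v x) + (K\<^sub>Z *v x) \<bullet> (R *v (K\<^sub>Z *v x))"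
    unfolding Q_Z_def
    by (simp only: matrix_vector_mult_add_rdistrib inner_add_right matrix_vector_mul_assoc[symmetric])
      (metis inner_commute inner_transpose_mult)
  then show ?thesis
    using Q_posD[OF assms] pos_def_nonneg[OF R_posD, of "K\<^sub>Z *v x"] by simp
qed

lemmas form_nonneg =
  pos_def_nonneg[OF Q_posD] pos_def_nonneg[OF R_posD] pos_def_nonneg[OF Q_Z_posD] pos_def_nonneg[OF P_posD]

section \<open>Coercivity of the cost\<close>

lemma stage_cost_le:
  assumes "k < N"
  shows "z k \<bullet> (Q *v z k) + v k \<bullet> (R *v v k) \<le> cost (z, v, \<omega>)"
proof -
  have "z k \<bullet> (Q *v z k) + v k \<bullet> (R *v v k) \<le> (\<Sum>k<N. z k \<bullet> (Q *v z k) + v k \<bullet> (R *v v k))"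
    using assms form_nonneg
    by (intro member_le_sum[of k "{..<N}" "\<lambda>k. z k \<bullet> (Q *v z k) + v k \<bullet> (R *v v k)"]) auto
  moreover have "0 \<le> (\<Sum>k\<in>{N..<N + N\<^sub>Z}. z k \<bullet> (Q_Z *v z k))"
    by (intro sum_nonneg form_nonneg)
  ultimately show ?thesis
    using form_nonneg(4)[of "z (N + N\<^sub>Z)"] by (simp add: cost.simps)
qed

lemma terminal_stage_cost_le:
  assumes "N \<le> k" "k < N + N\<^sub>Z"
  shows "z k \<bullet> (Q_Z *v z k) \<le> cost (z, v, \<omega>)"
proof -
  have "z k \<bullet> (Q_Z *v z k) \<le> (\<Sum>k\<in>{N..<N + N\<^sub>Z}. z k \<bullet> (Q_Z *v z k))"
    using assms form_nonneg
    by (intro member_le_sum[of k "{N..<N + N\<^sub>Z}" "\<lambda>k. z k \<bullet> (Q_Z *v z k)"]) auto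
  moreover have "0 \<le> (\<Sum>k<N. z k \<bullet> (Q *v z k) + v k \<bullet> (R *v v k))"
    by (intro sum_nonneg add_nonneg_nonneg form_nonneg)
  ultimately show ?thesis
    using form_nonneg(4)[of "z (N + N\<^sub>Z)"] by (simp add: cost.simps)
qed

lemma terminal_cost_le: "z (N + N\<^sub>Z) \<bullet> (P *v z (N + N\<^sub>Z)) \<le> cost (z, v, \<omega>)"
proof -
  have "0 \<le> (\<Sum>k<N. z k \<bullet> (Q *v z k) + v k \<bullet> (R *v v k))"
    by (intro sum_nonneg add_nonneg_nonneg form_nonneg)
  moreover have "0 \<le> (\<Sum>k\<in>{N..<N + N\<^sub>Z}. z k \<bullet> (Q_Z *v z k))"
    by (intro sum_nonneg form_nonneg)
  ultimately show ?thesis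
    by (simp add: cost.simps)
qed

text \<open>All summands are nonnegative, so each is at most the total, and every entry within the
  horizon occurs in a positive definite one: \<open>Q\<close> and \<open>R\<close> before
  \<open>N\<close>, \<open>Q_Z\<close> on the terminal segment, \<open>P\<close> at its end.\<close>

lemma cost_sublevel_bounded:
  obtains r where "0 \<le> r"
    and "\<And>z v \<omega> k. cost (z, v, \<omega>) \<le> b \<Longrightarrow> k \<le> N + N\<^sub>Z \<Longrightarrow> norm (z k) \<le> r"
    and "\<And>z v \<omega> k. cost (z, v, \<omega>) \<le> b \<Longrightarrow> k < N \<Longrightarrow> norm (v k) \<le> r"
proof -
  obtain r1 where r1: "\<And>x. x \<bullet> (Q *v x) \<le> b \<Longrightarrow> norm x \<le> r1"
    using pos_def_sublevel_bounded[OF Q_posD] by blast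
  obtain r2 where r2: "\<And>x. x \<bullet> (R *v x) \<le> b \<Longrightarrow> norm x \<le> r2"
    using pos_def_sublevel_bounded[OF R_posD] by blast
  obtain r3 where r3: "\<And>x. x \<bullet> (Q_Z *v x) \<le> b \<Longrightarrow> norm x \<le> r3"
    using pos_def_sublevel_bounded[OF Q_Z_posD] by blast
  obtain r4 where r4: "\<And>x. x \<bullet> (P *v x) \<le> b \<Longrightarrow> norm x \<le> r4"
    using pos_def_sublevel_bounded[OF P_posD] by blast
  \<comment> \<open>A radius belonging to an empty sublevel set may be negative, hence the absolute
    values.\<close>
  let ?r = "\<bar>r1\<bar> + \<bar>r2\<bar> + \<bar>r3\<bar> + \<bar>r4\<bar>"
  show thesis
  proof (rule that[of ?r])
    fix z :: "nat \<Rightarrow> real^'n" and v :: "nat \<Rightarrow> real^'m" and \<omega> :: "nat \<Rightarrow> real^'n" and k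
    assume cost: "cost (z, v, \<omega>) \<le> b" and "k \<le> N + N\<^sub>Z"
    then consider "k < N" | "N \<le> k" "k < N + N\<^sub>Z" | "k = N + N\<^sub>Z"
      by linarith
    then show "norm (z k) \<le> ?r"
    proof cases
      case 1
      then have "z k \<bullet> (Q *v z k) \<le> b"
        using stage_cost_le[of k z v \<omega>] form_nonneg(2)[of "v k"] cost by linarith
      from r1[OF this] show ?thesis by linarith
    next
      case 2
      then have "z k \<bullet> (Q_Z *v z k) \<le> b"
        using terminal_stage_cost_le[of k z v \<omega>] cost by linarith
      from r3[OF this] show ?thesis by linarith
    next
      case 3
      then have "z k \<bullet> (P *v z k) \<le> b"
        using terminal_cost_le[of z v \<omega>] cost by simp
      from r4[OF this] show ?thesis by linarith
    qed
  next
    fix z :: "nat \<Rightarrow> real^'n" and v :: "nat \<Rightarrow> real^'m" and \<omega> :: "nat \<Rightarrow> real^'n" and k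
    assume cost: "cost (z, v, \<omega>) \<le> b" and "k < N"
    then have "v k \<bullet> (R *v v k) \<le> b"
      using stage_cost_le[of k z v \<omega>] form_nonneg(1)[of "z k"] by linarith
    from r2[OF this] show "norm (v k) \<le> ?r" by linarith
  qed simp
qed

section \<open>Strict convexity and uniqueness of the optimal nominal trajectory\<close>

lemma cost_parallelogram:
  "cost (\<lambda>k. (1/2) *\<^sub>R (z k + z' k), \<lambda>k. (1/2) *\<^sub>R (v k + v' k), \<omega>\<^sub>1) +
   cost (\<lambda>k. (1/2) *\<^sub>R (z k - z' k), \<lambda>k. (1/2) *\<^sub>R (v k - v' k), \<omega>\<^sub>2) =
   (1/2) * cost (z, v, \<omega>\<^sub>3) + (1/2) * cost (z', v', \<omega>\<^sub>4)"
proof -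
  have sum_eq: "sum g1 X + sum g2 X = (1/2) * sum g3 X + (1/2) * sum g4 X"
    if "\<And>k. g1 k + g2 k = (1/2) * g3 k + (1/2) * g4 k" for X and g1 g2 g3 g4 :: "nat \<Rightarrow> real"
    using that by (simp add: sum_distrib_left flip: sum.distrib)
  note par = quadratic_form_parallelogram
  define q1 where "q1 z v k = z k \<bullet> (Q *v z k) + v k \<bullet> (R *v v k)" for z v and k :: nat
  define q2 where "q2 z k = z k \<bullet> (Q_Z *v z k)" for z and k :: nat
  define q3 where "q3 z = z (N + N\<^sub>Z) \<bullet> (P *v z (N + N\<^sub>Z))" for z
  define zm vm zd vd where "zm = (\<lambda>k. (1/2) *\<^sub>R (z k + z' k))" "vm = (\<lambda>k. (1/2) *\<^sub>R (v k + v' k))"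
    "zd = (\<lambda>k. (1/2) *\<^sub>R (z k - z' k))" "vd = (\<lambda>k. (1/2) *\<^sub>R (v k - v' k))"
  note defs = zm_vm_zd_vd_def
  have "q1 zm vm k + q1 zd vd k = (1/2) * q1 z v k + (1/2) * q1 z' v' k" for k
    using par[of "z k" "z' k" Q] par[of "v k" "v' k" R] unfolding q1_def defs by argo
  moreover have "q2 zm k + q2 zd k = (1/2) * q2 z k + (1/2) * q2 z' k" for k
    unfolding q2_def defs by (rule par)
  moreover have "q3 zm + q3 zd = (1/2) * q3 z + (1/2) * q3 z'"
    unfolding q3_def defs by (rule par)
  ultimately show ?thesis
    using sum_eq[of "q1 zm vm" "q1 zd vd" "q1 z v" "q1 z' v'" "{..<N}"]
      sum_eq[of "q2 zm" "q2 zd" "q2 z" "q2 z'" "{N..<N + N\<^sub>Z}"]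
    unfolding cost.simps q1_def[symmetric] q2_def[symmetric] q3_def[symmetric] defs[symmetric]
    by argo
qed

text \<open>Every constraint is an affine equation or a half-space, so the feasible set is
  convex.\<close>

lemma feasible_midpoint:
  assumes "feasible x (z, v, \<omega>)" "feasible x (z', v', \<omega>')"
  shows "feasible x (\<lambda>k. (1/2) *\<^sub>R (z k + z' k), \<lambda>k. (1/2) *\<^sub>R (v k + v' k),
    \<lambda>k. (1/2) *\<^sub>R (\<omega> k + \<omega>' k))"
proof -
  have mid: "y \<bullet> ((1/2) *\<^sub>R (a + b)) \<le> t" if "y \<bullet> a \<le> t" "y \<bullet> b \<le> t" for y a b :: "real^'n" and t
    using that by (simp add: inner_add_right)
  have mid2: "y \<bullet> ((1/2) *\<^sub>R (a + b)) + y' \<bullet> ((1/2) *\<^sub>R (a' + b')) \<le> t"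
    if "y \<bullet> a + y' \<bullet> a' \<le> t" "y \<bullet> b + y' \<bullet> b' \<le> t"
    for y a b :: "real^'n" and y' a' b' :: "real^'m" and t
    using that by (simp add: inner_add_right field_simps)
  have "x = (1/2) *\<^sub>R x + (1/2) *\<^sub>R x"
    by (simp flip: scaleR_add_left)
  also have "\<dots> = (1/2) *\<^sub>R (z 0 + z' 0) + (1 / (1 - \<alpha>)) *\<^sub>R
      (\<Sum>j<N\<^sub>S. mat_pow (A + B ** K\<^sub>S) j *v ((1/2) *\<^sub>R (\<omega> j + \<omega>' j)))"
  proof -
    define L where "L \<omega> = (\<Sum>j<N\<^sub>S. mat_pow (A + B ** K\<^sub>S) j *v \<omega> j)" for \<omega> :: "nat \<Rightarrow> real^'n"
    have "L (\<lambda>j. (1/2) *\<^sub>R (\<omega> j + \<omega>' j)) = (1/2) *\<^sub>R (L \<omega> + L \<omega>')"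
      by (simp add: L_def matrix_vector_mult_scaleR matrix_vector_right_distrib
          flip: scaleR_sum_right sum.distrib)
    moreover have "x = z 0 + (1 / (1 - \<alpha>)) *\<^sub>R L \<omega>" "x = z' 0 + (1 / (1 - \<alpha>)) *\<^sub>R L \<omega>'"
      using assms unfolding feasible.simps L_def by blast+
    then have "(1/2) *\<^sub>R x + (1/2) *\<^sub>R x =
        (1/2) *\<^sub>R (z 0 + (1 / (1 - \<alpha>)) *\<^sub>R L \<omega>) + (1/2) *\<^sub>R (z' 0 + (1 / (1 - \<alpha>)) *\<^sub>R L \<omega>')"
      by metis
    ultimately show ?thesis
      unfolding L_def[symmetric] by (simp add: scaleR_add_right mult.commute)
  qed
  finally have x_eq: "x = \<dots>" .
  show ?thesis
    unfolding feasible.simps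
  proof (intro conjI allI impI ballI)
    fix j i assume "j < N\<^sub>S" "i \<in> {1..q}"
    then show "e i \<bullet> (1/2) *\<^sub>R (\<omega> j + \<omega>' j) \<le> 1"
      using assms by (intro mid) (simp_all add: feasible.simps)
  next
    fix k assume "k < N"
    then show "(1/2) *\<^sub>R (z (k + 1) + z' (k + 1)) =
        A *v ((1/2) *\<^sub>R (z k + z' k)) + B *v ((1/2) *\<^sub>R (v k + v' k))"
      using assms by (simp add: feasible.simps matrix_vector_mult_scaleR matrix_vector_right_distrib scaleR_add_right)
  next
    fix k i assume "k < N" "i \<in> {1..p}"
    then show "c i \<bullet> (1/2) *\<^sub>R (z k + z' k) + d i \<bullet> (1/2) *\<^sub>R (v k + v' k) \<le> 1 - f i"
      using assms by (intro mid2) (simp_all add: feasible.simps)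
  next
    fix k assume "k < N\<^sub>Z"
    then show "(1/2) *\<^sub>R (z (N + k + 1) + z' (N + k + 1)) =
        (A + B ** K\<^sub>Z) *v ((1/2) *\<^sub>R (z (N + k) + z' (N + k)))"
      using assms by (simp add: feasible.simps matrix_vector_mult_scaleR matrix_vector_right_distrib)
  next
    fix k i assume "k \<le> N\<^sub>Z" "i \<in> {1..p}"
    then show "(c i + transpose K\<^sub>Z *v d i) \<bullet> (1/2) *\<^sub>R (z (N + k) + z' (N + k)) \<le> 1 - f i"
      using assms by (intro mid) (simp_all add: feasible.simps)
  qed (rule x_eq)
qed

text \<open>The midpoint of two minimizers is feasible and hence no cheaper than either. The
  parallelogram identity then leaves cost at most 0 for half their difference, and positive
  definiteness makes its stage entries vanish.\<close>

lemma minimizer_unique: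
  assumes "minimizer x (z, v, \<omega>)" "minimizer x (z', v', \<omega>')" "k < N"
  shows "z k = z' k" "v k = v' k"
proof -
  define zm vm \<omega>m where "zm = (\<lambda>k. (1/2) *\<^sub>R (z k + z' k))"
    and "vm = (\<lambda>k. (1/2) *\<^sub>R (v k + v' k))" and "\<omega>m = (\<lambda>k. (1/2) *\<^sub>R (\<omega> k + \<omega>' k))"
  define zd vd where "zd = (\<lambda>k. (1/2) *\<^sub>R (z k - z' k))"
    and "vd = (\<lambda>k. (1/2) *\<^sub>R (v k - v' k))"
  have "feasible x (zm, vm, \<omega>m)"
    unfolding zm_def vm_def \<omega>m_def using assms
    by (intro feasible_midpoint) (auto simp: minimizer_def is_arg_min_def)
  then have "cost (z, v, \<omega>) \<le> cost (zm, vm, \<omega>m)" "cost (z', v', \<omega>') \<le> cost (zm, vm, \<omega>m)"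
    using assms unfolding minimizer_def is_arg_min_linorder by blast+
  \<comment> \<open>The cost ignores its third component, so any sequence can fill that slot for the
    difference.\<close>
  moreover have "cost (zm, vm, \<omega>m) + cost (zd, vd, \<omega>) = (1/2) * cost (z, v, \<omega>) + (1/2) * cost (z', v', \<omega>')"
    unfolding zm_def vm_def zd_def vd_def by (rule cost_parallelogram)
  ultimately have "cost (zd, vd, \<omega>) \<le> 0"
    by linarith
  then have "zd k \<bullet> (Q *v zd k) + vd k \<bullet> (R *v vd k) \<le> 0"
    using stage_cost_le[OF assms(3), of zd vd \<omega>] by linarith
  then have "zd k = 0" "vd k = 0"
    using Q_posD[of "zd k"] R_posD[of "vd k"] form_nonneg(1)[of "zd k"] form_nonneg(2)[of "vd k"]
    by linarith+
  then show "z k = z' k" "v k = v' k"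
    by (simp_all add: zd_def vd_def)
qed

section \<open>Existence of a minimizer\<close>

lemma closed_feasible: "closed {D. feasible x D}"
proof -
  \<comment> \<open>Projections replace the pattern match on triples, so that the constraints unfold
    into conditions on continuous coordinates.\<close>
  have "{D. feasible x D} = {D. feasible x (fst D, fst (snd D), snd (snd D))}"
    by simp
  also have "closed \<dots>"
    unfolding feasible.simps Ball_def
    by (intro closed_Collect_conj closed_Collect_all closed_Collect_imp_const closed_Collect_eq
        closed_Collect_le continuous_intros continuous_on_product_then_coordinatewise)
  finally show ?thesis .
qed

lemma continuous_on_cost: "continuous_on X cost"
proof -
  have "continuous_on X (\<lambda>D. cost (fst D, fst (snd D), snd (snd D)))"
    unfolding cost.simps
    by (intro continuous_intros continuous_on_product_then_coordinatewise)
  then show ?thesis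
    by simp
qed

lemma bounded_W: "bounded W_set"
  and convex_W: "convex W_set"
  and zero_in_W: "0 \<in> W_set"
  using W_proper interior_subset by (auto simp: proper_C_set_def proper_D_set_def)

lemma in_W_iff: "w \<in> W_set \<longleftrightarrow> (\<forall>i\<in>{1..q}. e i \<bullet> w \<le> 1)"
  by (simp add: W_set_def W_halfspace_def)

text \<open>Direct method: a feasible point fixes a cost level \<open>b\<close>, coercivity and
  boundedness of \<open>W_set\<close> confine the relevant entries below that level to a compact
  box, and the continuous cost attains its minimum on the feasible part of the box.\<close>

lemma minimizer_exists:
  assumes "x \<in> controllable_set"
  obtains z v \<omega> where "minimizer x (z, v, \<omega>)"
proof -
  obtain z0 v0 \<omega>0 where D0: "feasible x (z0, v0, \<omega>0)"
    using assms by (auto simp: controllable_set_def)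
  define b where "b = cost (z0, v0, \<omega>0)"
  obtain rW where rW: "\<And>w. w \<in> W_set \<Longrightarrow> norm w \<le> rW"
    using bounded_W by (auto simp: bounded_iff)
  obtain r where r: "0 \<le> r"
    "\<And>z v \<omega> k. cost (z, v, \<omega>) \<le> b \<Longrightarrow> k \<le> N + N\<^sub>Z \<Longrightarrow> norm (z k) \<le> r"
    "\<And>z v \<omega> k. cost (z, v, \<omega>) \<le> b \<Longrightarrow> k < N \<Longrightarrow> norm (v k) \<le> r"
    using cost_sublevel_bounded[of b] by blast
  \<comment> \<open>The cost controls only \<open>z\<close> and \<open>v\<close>; the bound on
    \<omega> comes from \<open>W_set\<close>. Nonnegative radii leave room for zero entries.\<close>
  define Box where "Box = PiE UNIV (\<lambda>_::nat. cball (0::real^'n) r) \<times>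
    (PiE UNIV (\<lambda>_::nat. cball (0::real^'m) r) \<times> PiE UNIV (\<lambda>_::nat. cball (0::real^'n) \<bar>rW\<bar>))"
  \<comment> \<open>Entries beyond the horizon are unconstrained and free of cost, so they are zeroed to fit into the box.\<close>
  have trunc: "\<exists>D'\<in>Box \<inter> {D. feasible x D}. cost D' = cost (z, v, \<omega>)"
    if feas: "feasible x (z, v, \<omega>)" and le: "cost (z, v, \<omega>) \<le> b" for z v \<omega>
  proof
    let ?z = "\<lambda>k. if k \<le> N + N\<^sub>Z then z k else 0"
    let ?v = "\<lambda>k. if k < N then v k else 0"
    let ?\<omega> = "\<lambda>k. if k < N\<^sub>S then \<omega> k else 0"
    show "cost (?z, ?v, ?\<omega>) = cost (z, v, \<omega>)"
      by (simp add: cost.simps)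
    have "feasible x (?z, ?v, ?\<omega>)"
      using feas by (simp add: feasible.simps)
    moreover have "\<omega> k \<in> W_set" if "k < N\<^sub>S" for k
      using feas that by (simp add: in_W_iff feasible.simps)
    then have "(?z, ?v, ?\<omega>) \<in> Box"
      unfolding Box_def using r le order_trans[OF rW abs_ge_self] by (auto simp: PiE_def)
    ultimately show "(?z, ?v, ?\<omega>) \<in> Box \<inter> {D. feasible x D}"
      by blast
  qed
  have "compact (Box \<inter> {D. feasible x D})"
    unfolding Box_def by (intro compact_Int_closed compact_Times compact_PiE_UNIV compact_cball closed_feasible)
  moreover have "Box \<inter> {D. feasible x D} \<noteq> {}"
    using trunc[OF D0] by (auto simp: b_def)
  ultimately obtain D where D: "D \<in> Box \<inter> {D. feasible x D}"
    "\<And>D'. D' \<in> Box \<inter> {D. feasible x D} \<Longrightarrow> cost D \<le> cost D'"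
    using continuous_attains_inf[OF _ _ continuous_on_cost] by metis
  have "cost D \<le> cost (z, v, \<omega>)" if "feasible x (z, v, \<omega>)" for z v \<omega>
  proof (cases "cost (z, v, \<omega>) \<le> b")
    case True
    then show ?thesis
      using trunc[OF that] D(2) by force
  next
    \<comment> \<open>A competitor above level \<open>b\<close> costs more than the truncated
      initial point, which lies in the box.\<close>
    case False
    then show ?thesis
      using trunc[OF D0] D(2) unfolding b_def by force
  qed
  then have "minimizer x D"
    using D(1) unfolding minimizer_def is_arg_min_linorder by auto
  then show thesis
    using that by (cases D) auto
qed

text \<open>Uniqueness resolves the definite descriptions, so any minimizer may be used to evaluate
  the control law. The bound on \<open>N\<close> puts index 0 in the range of
  \<open>minimizer_unique\<close>.\<close>

lemma \<kappa>_eq: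
  assumes "1 \<le> N" "minimizer x (z, v, \<omega>)"
  shows "\<kappa> x = v 0 + K\<^sub>S *v (x - z 0)"
proof -
  have "z' 0 = z 0" "v' 0 = v 0" if "minimizer x (z', v', \<omega>')" for z' v' \<omega>'
    using minimizer_unique[OF that assms(2), of 0] assms(1) by simp_all
  then have "z_opt 0 x = z 0" "v_opt 0 x = v 0"
    unfolding z_opt_def v_opt_def using assms(2) by (intro the_equality; blast)+
  then show ?thesis
    by (simp add: \<kappa>_def)
qed

section \<open>The tube cross-section\<close>

text \<open>Links the Minkowski sum to the explicit disturbance sequence \<omega> in the constraints
  of the optimization problem.\<close>

lemma in_S_iff:
  "s \<in> S_set \<longleftrightarrow> (\<exists>\<omega>. (\<forall>j<N\<^sub>S. \<omega> j \<in> W_set) \<and>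
    s = (1 / (1 - \<alpha>)) *\<^sub>R (\<Sum>j<N\<^sub>S. mat_pow (A + B ** K\<^sub>S) j *v \<omega> j))"
proof -
  have "(\<Sum>j<N\<^sub>S. pow_image (A + B ** K\<^sub>S) j W_set) =
    {\<Sum>j<N\<^sub>S. mat_pow (A + B ** K\<^sub>S) j *v \<omega> j | \<omega>. \<forall>j<N\<^sub>S. \<omega> j \<in> W_set}" (is "?L = ?R")
  proof (intro equalityI subsetI)
    fix y assume "y \<in> ?L"
    then obtain t where t: "y = sum t {..<N\<^sub>S}"
      and "\<forall>j\<in>{..<N\<^sub>S}. t j \<in> pow_image (A + B ** K\<^sub>S) j W_set"
      unfolding set_sum_alt[OF finite_lessThan] by blast
    then have "\<forall>j<N\<^sub>S. \<exists>w. w \<in> W_set \<and> t j = mat_pow (A + B ** K\<^sub>S) j *v w"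
      by (auto simp: pow_image_def)
    then obtain \<omega> where "\<forall>j<N\<^sub>S. \<omega> j \<in> W_set \<and> t j = mat_pow (A + B ** K\<^sub>S) j *v \<omega> j"
      by metis
    then show "y \<in> ?R"
      using t by (auto intro!: exI[of _ \<omega>])
  qed (auto simp: set_sum_alt pow_image_def)
  then show ?thesis
    unfolding S_set_def by auto
qed

text \<open>Together with \<open>S_nonempty\<close>, this makes the supremum defining
  \<open>f\<close> a genuine least upper bound.\<close>

lemma bounded_S: "bounded S_set"
proof -
  have img: "bounded (pow_image (A + B ** K\<^sub>S) j W_set)" for j
    unfolding pow_image_def by (intro bounded_linear_image bounded_W matrix_vector_mul_bounded_linear)
  have "bounded (\<Sum>j<n. pow_image (A + B ** K\<^sub>S) j W_set)" for n :: nat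
  proof (induction n)
    case (Suc n)
    then show ?case
      using bounded_plus[OF Suc img[of n]] by (simp add: set_plus_image)
  qed (simp add: set_zero)
  then show ?thesis
    unfolding S_set_def by (intro bounded_scaling)
qed

lemma S_nonempty: "S_set \<noteq> {}"
proof -
  have "0 \<in> S_set"
    unfolding in_S_iff using zero_in_W by (intro exI[of _ "\<lambda>_. 0"]) simp
  then show ?thesis
    by blast
qed

lemma bdd_above_inner_S: "bdd_above ((\<lambda>s. y \<bullet> s) ` S_set)"
  by (intro bounded_imp_bdd_above bounded_linear_image bounded_S bounded_linear_inner_right)

lemma f_le_iff: "f i \<le> t \<longleftrightarrow> (\<forall>s\<in>S_set. (c i + transpose K\<^sub>S *v d i) \<bullet> s \<le> t)"
  unfolding f_def support_function_def by (intro cSUP_le_iff S_nonempty bdd_above_inner_S)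

lemma inner_tube:
  "c i \<bullet> (z + s) + d i \<bullet> (v + K\<^sub>S *v s) =
    c i \<bullet> z + d i \<bullet> v + (c i + transpose K\<^sub>S *v d i) \<bullet> s"
  unfolding inner_add_left inner_add_right inner_transpose_mult by simp

text \<open>By \<open>inner_tube\<close> the error \<open>s\<close> enters the \<open>i\<close>-th
  constraint additively, and its worst case over the cross-section is \<open>f i\<close>. Tightening
  by \<open>f i\<close> is therefore exact.\<close>

lemma in_Y_S_iff: "(z, v) \<in> Y_S \<longleftrightarrow> (\<forall>i\<in>{1..p}. c i \<bullet> z + d i \<bullet> v \<le> 1 - f i)"
proof -
  have "(z, v) \<in> Y_S \<longleftrightarrow> (\<forall>i\<in>{1..p}. \<forall>s\<in>S_set. c i \<bullet> (z + s) + d i \<bullet> (v + K\<^sub>S *v s) \<le> 1)"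
    by (auto simp: Y_S_def Y_set_def Y_halfspace_def)
  also have "\<dots> \<longleftrightarrow> (\<forall>i\<in>{1..p}. f i \<le> 1 - (c i \<bullet> z + d i \<bullet> v))"
    unfolding f_le_iff inner_tube by (simp add: algebra_simps)
  finally show ?thesis
    by (simp add: algebra_simps)
qed

lemma in_Z_S_iff: "z \<in> Z_S \<longleftrightarrow> (\<forall>i\<in>{1..p}. (c i + transpose K\<^sub>Z *v d i) \<bullet> z \<le> 1 - f i)"
  unfolding Z_S_def mem_Collect_eq in_Y_S_iff inner_add_left inner_transpose_mult by (rule refl)

text \<open>For \<open>N\<^sub>S = 0\<close> the containment would put \<open>W_set\<close> inside
  its own \<alpha>-scaling. Iterating shrinks the bounded set to the origin, against its nonempty
  interior.\<close>

lemma N_S_pos: "0 < N\<^sub>S"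
proof (rule ccontr)
  assume "\<not> 0 < N\<^sub>S"
  then have sub: "W_set \<subseteq> (*\<^sub>R) \<alpha> ` W_set"
    using N_S by (simp add: pow_image_def)
  obtain r where r: "\<And>w. w \<in> W_set \<Longrightarrow> norm w \<le> r"
    using bounded_W by (auto simp: bounded_iff)
  have pow: "norm w \<le> \<alpha> ^ n * r" if "w \<in> W_set" for w n
    using that
  proof (induction n arbitrary: w)
    case (Suc n)
    then obtain w' where "w' \<in> W_set" "w = \<alpha> *\<^sub>R w'"
      using sub by blast
    then show ?case
      using Suc.IH[of w'] \<alpha>_range by (simp add: mult.assoc mult_left_mono)
  qed (simp add: r)
  have "w = 0" if "w \<in> W_set" for w
  proof -
    have "(\<lambda>n. \<alpha> ^ n * r) \<longlonglongrightarrow> 0"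
      using \<alpha>_range by (intro tendsto_mult_left_zero LIMSEQ_realpow_zero) auto
    then have "norm w \<le> 0"
      using pow[OF that] by (intro LIMSEQ_le_const) auto
    then show ?thesis by simp
  qed
  then have "W_set \<subseteq> {0}"
    by blast
  then have "interior W_set \<subseteq> {}"
    using interior_mono[of W_set "{0}"] by simp
  then show False
    using W_proper by (auto simp: proper_C_set_def proper_D_set_def)
qed

text \<open>Applying \<open>M\<close> raises every power by one. Only the last term overflows, and
  the contraction assumption on \<open>W_set\<close> returns it to the start of the sum as \<alpha>
  times a disturbance.\<close>

lemma S_robust_invariant:
  assumes "s \<in> S_set" "w \<in> W_set"
  shows "(A + B ** K\<^sub>S) *v s + w \<in> S_set"
proof -
  define M where "M = A + B ** K\<^sub>S"
  obtain \<omega> where \<omega>: "\<forall>j<N\<^sub>S. \<omega> j \<in> W_set"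
    and s: "s = (1 / (1 - \<alpha>)) *\<^sub>R (\<Sum>j<N\<^sub>S. mat_pow M j *v \<omega> j)"
    using assms(1) by (auto simp: in_S_iff M_def)
  obtain m where m: "N\<^sub>S = Suc m"
    using N_S_pos by (cases "N\<^sub>S") auto
  have "mat_pow M N\<^sub>S *v \<omega> m \<in> pow_image M N\<^sub>S W_set"
    using \<omega> m by (auto simp: pow_image_def)
  then obtain w' where w': "w' \<in> W_set" "mat_pow M N\<^sub>S *v \<omega> m = \<alpha> *\<^sub>R w'"
    using N_S unfolding M_def by blast
  \<comment> \<open>The overflow leaves weight \<open>1 - \<alpha>\<close> for the new disturbance
    \<open>w\<close>; convexity keeps the combination in \<open>W_set\<close>, and the prefactor of
    the sum restores \<open>w\<close> to weight 1.\<close>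
  define \<omega>' where "\<omega>' j = (case j of 0 \<Rightarrow> \<alpha> *\<^sub>R w' + (1 - \<alpha>) *\<^sub>R w | Suc j \<Rightarrow> \<omega> j)" for j
  have "\<omega>' j \<in> W_set" if "j < N\<^sub>S" for j
    using that \<omega> w'(1) assms(2) \<alpha>_range convexD[OF convex_W, of w' w \<alpha> "1 - \<alpha>"]
    by (cases j) (auto simp: \<omega>'_def)
  moreover have "M *v s + w = (1 / (1 - \<alpha>)) *\<^sub>R (\<Sum>j<N\<^sub>S. mat_pow M j *v \<omega>' j)"
  proof -
    have "M *v (\<Sum>j<N\<^sub>S. mat_pow M j *v \<omega> j) = (\<Sum>j<N\<^sub>S. mat_pow M (Suc j) *v \<omega> j)"
      by (simp add: linear_sum[OF matrix_vector_mul_linear] matrix_vector_mul_assoc)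
    also have "\<dots> = (\<Sum>j<m. mat_pow M (Suc j) *v \<omega> j) + \<alpha> *\<^sub>R w'"
      using w'(2) by (simp only: m sum.lessThan_Suc)
    finally have "M *v (\<Sum>j<N\<^sub>S. mat_pow M j *v \<omega> j) + (1 - \<alpha>) *\<^sub>R w =
      (\<Sum>j<N\<^sub>S. mat_pow M j *v \<omega>' j)"
      unfolding m sum.lessThan_Suc_shift by (simp add: \<omega>'_def)
    then have "(1 / (1 - \<alpha>)) *\<^sub>R (\<Sum>j<N\<^sub>S. mat_pow M j *v \<omega>' j) =
      (1 / (1 - \<alpha>)) *\<^sub>R (M *v (\<Sum>j<N\<^sub>S. mat_pow M j *v \<omega> j) + (1 - \<alpha>) *\<^sub>R w)"
      by simp
    then show ?thesis
      using \<alpha>_range by (simp add: s matrix_vector_mult_scaleR scaleR_add_right)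
  qed
  ultimately show ?thesis
    unfolding in_S_iff M_def[symmetric] by blast
qed

section \<open>The shifted trajectory\<close>

text \<open>Eliminates \<omega> and replaces the tightened inequalities by set memberships, the form
  in which the shift argument runs.\<close>

lemma feasible_iff:
  "(\<exists>\<omega>. feasible x (z, v, \<omega>)) \<longleftrightarrow>
     x - z 0 \<in> S_set \<and>
     (\<forall>k<N. z (k + 1) = A *v z k + B *v v k) \<and>
     (\<forall>k<N. (z k, v k) \<in> Y_S) \<and>
     (\<forall>k<N\<^sub>Z. z (N + k + 1) = (A + B ** K\<^sub>Z) *v z (N + k)) \<and>
     (\<forall>k\<le>N\<^sub>Z. z (N + k) \<in> Z_S)"
  unfolding in_S_iff in_Y_S_iff in_Z_S_iff in_W_iff feasible.simps
  by (auto simp: algebra_simps)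

lemma successor_controllable:
  assumes N: "1 \<le> N" and feas: "feasible x (z, v, \<omega>)" and w: "w \<in> W_set"
  shows "A *v x + B *v (v 0 + K\<^sub>S *v (x - z 0)) + w \<in> controllable_set"
proof -
  define M where "M = A + B ** K\<^sub>Z"
  define x' where "x' = A *v x + B *v (v 0 + K\<^sub>S *v (x - z 0)) + w"
  \<comment> \<open>The only new state is the last one, one terminal step beyond the old horizon.
    The last shifted input acts at \<open>z' (N - 1) = z N\<close>, where the terminal feedback
    takes over.\<close>
  define z' where "z' k = (if k < N + N\<^sub>Z then z (k + 1) else M *v z (N + N\<^sub>Z))" for k
  define v' where "v' k = (if k < N - 1 then v (k + 1) else K\<^sub>Z *v z N)" for k
  have s: "x - z 0 \<in> S_set"
    and dyn: "\<And>k. k < N \<Longrightarrow> z (k + 1) = A *v z k + B *v v k"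
    and Y: "\<And>k. k < N \<Longrightarrow> (z k, v k) \<in> Y_S"
    and term_dyn: "\<And>k. k < N\<^sub>Z \<Longrightarrow> z (N + k + 1) = M *v z (N + k)"
    and term_Z: "\<And>k. k \<le> N\<^sub>Z \<Longrightarrow> z (N + k) \<in> Z_S"
    using feas feasible_iff[of x z v] unfolding M_def by blast+
  have M_eq: "M *v y = A *v y + B *v (K\<^sub>Z *v y)" for y
    by (simp add: M_def matrix_vector_mult_add_rdistrib matrix_vector_mul_assoc)
  have pow: "z (N + k) = mat_pow M k *v z N" if "k \<le> N\<^sub>Z" for k
    using that
  proof (induction k)
    case (Suc k)
    then show ?case
      using term_dyn[of k] by (simp add: matrix_vector_mul_assoc)
  qed simp
  \<comment> \<open>The terminal states are iterates of \<open>z N\<close>, so their constraints say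
    that \<open>z N\<close> lies in \<open>Z_f\<close>. The assumption on \<open>N\<^sub>Z\<close>
    then supplies the constraint for one further iterate, the appended state.\<close>
  have "z N \<in> Z_f"
    using pow term_Z by (auto simp: Z_f_def pow_preimage_def M_def)
  then have last_Z: "M *v z (N + N\<^sub>Z) \<in> Z_S"
    using N_Z pow[of "N\<^sub>Z"] by (auto simp: pow_preimage_def M_def matrix_vector_mul_assoc)
  have z'_term: "z' (N - 1 + k + 1) = M *v z (N + k)" if "k \<le> N\<^sub>Z" for k
    using that N term_dyn[of k] by (cases "k = N\<^sub>Z") (auto simp: z'_def)
  have z'_less: "z' k = z (k + 1)" if "k < N + N\<^sub>Z" for k
    using that by (simp add: z'_def)
  \<comment> \<open>The nominal input \<open>v 0\<close> cancels, leaving the error dynamics under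
    \<open>K\<^sub>S\<close>.\<close>
  have "x' - z' 0 = (A + B ** K\<^sub>S) *v (x - z 0) + w"
    using N dyn[of 0] z'_less[of 0]
    by (simp add: x'_def algebra_simps matrix_vector_mul_assoc)
  then have "x' - z' 0 \<in> S_set"
    using S_robust_invariant[OF s w] by simp
  moreover have "z' (k + 1) = A *v z' k + B *v v' k" if "k < N" for k
  proof (cases "k < N - 1")
    case True
    then show ?thesis
      using dyn[of "k + 1"] by (simp add: z'_less v'_def)
  next
    case False
    then have "k = N - 1"
      using that by simp
    then show ?thesis
      using N z'_term[of 0] z'_less[of k] by (simp add: v'_def M_eq)
  qed
  moreover have "(z' k, v' k) \<in> Y_S" if "k < N" for k
  proof (cases "k < N - 1")
    case True
    then show ?thesis
      using Y[of "k + 1"] by (simp add: z'_less v'_def)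
  next
    case False
    then have "k + 1 = N"
      using that by simp
    \<comment> \<open>The pair at the junction is \<open>z N\<close> with its terminal feedback,
      admissible because \<open>z N\<close> lies in \<open>Z_S\<close>.\<close>
    then show ?thesis
      using False term_Z[of 0] z'_less[of k] by (simp add: v'_def Z_S_def)
  qed
  moreover have "z' (N + k + 1) = M *v z' (N + k)" if "k < N\<^sub>Z" for k
    using that N z'_term[of "k + 1"] z'_less[of "N + k"] by simp
  moreover have "z' (N + k) \<in> Z_S" if "k \<le> N\<^sub>Z" for k
  proof (cases "k < N\<^sub>Z")
    case True
    then show ?thesis
      using term_Z[of "k + 1"] z'_less[of "N + k"] by simp
  next
    case False
    then show ?thesis
      using that last_Z by (simp add: z'_def)
  qed
  ultimately have "\<exists>\<omega>. feasible x' (z', v', \<omega>)"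
    unfolding feasible_iff M_def by blast
  then show ?thesis
    unfolding controllable_set_def x'_def by blast
qed

text \<open>The actual state is \<open>z 0\<close> plus an element of the cross-section, and
  membership in \<open>Y_S\<close> covers all such errors.\<close>

lemma tube_constraint:
  assumes "1 \<le> N" "feasible x (z, v, \<omega>)"
  shows "(x, v 0 + K\<^sub>S *v (x - z 0)) \<in> Y_set"
proof -
  have "x - z 0 \<in> S_set" "(z 0, v 0) \<in> Y_S"
    using assms feasible_iff[of x z v] by auto
  then have "(z 0 + (x - z 0), v 0 + K\<^sub>S *v (x - z 0)) \<in> Y_set"
    unfolding Y_S_def by blast
  then show ?thesis
    by simp
qed

end

theorem theorem2:
  fixes A :: "real^'n^'n" and B :: "real^'m^'n"
    and p :: nat and c :: "nat \<Rightarrow> real^'n" and d :: "nat \<Rightarrow> real^'m"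
    and q :: nat and e :: "nat \<Rightarrow> real^'n"
    and Q :: "real^'n^'n" and R :: "real^'m^'m" and P :: "real^'n^'n"
    and K\<^sub>S :: "real^'n^'m" and \<alpha> :: real and N\<^sub>S :: nat
    and K\<^sub>Z :: "real^'n^'m" and N\<^sub>Z :: nat and N :: nat
  assumes "rigid_tube_mpc A B p c d q e Q R P K\<^sub>S \<alpha> N\<^sub>S K\<^sub>Z N\<^sub>Z"
    and "1 \<le> N"
  shows "robust_positively_invariant A B
    (rigid_tube_mpc_data.W_set q e)
    (rigid_tube_mpc_data.Y_set p c d)
    (rigid_tube_mpc_data.\<kappa> A B p c d q e Q R P K\<^sub>S \<alpha> N\<^sub>S K\<^sub>Z N\<^sub>Z N)
    (rigid_tube_mpc_data.controllable_set A B p c d q e K\<^sub>S \<alpha> N\<^sub>S K\<^sub>Z N\<^sub>Z N)"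
proof -
  interpret rigid_tube_mpc A B p c d q e Q R P "K\<^sub>S" \<alpha> "N\<^sub>S" "K\<^sub>Z" "N\<^sub>Z" N
    by fact
  have "A *v x + B *v \<kappa> x + w \<in> controllable_set" "(x, \<kappa> x) \<in> Y_set"
    if "x \<in> controllable_set" "w \<in> W_set" for x w
  proof -
    obtain z v \<omega> where min: "minimizer x (z, v, \<omega>)"
      using minimizer_exists[OF \<open>x \<in> controllable_set\<close>] .
    then have "feasible x (z, v, \<omega>)"
      by (simp add: minimizer_def is_arg_min_def)
    then show "A *v x + B *v \<kappa> x + w \<in> controllable_set" "(x, \<kappa> x) \<in> Y_set"
      unfolding \<kappa>_eq[OF \<open>1 \<le> N\<close> min]
      using successor_controllable tube_constraint \<open>1 \<le> N\<close> \<open>w \<in> W_set\<close> by blast+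
  qed
  \<comment> \<open>The state and input constraint does not mention \<open>w\<close>; the
    disturbance 0 serves to extract it.\<close>
  then show ?thesis
    unfolding robust_positively_invariant_def using zero_in_W by (auto simp: set_plus_def)
qed

end
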